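(* Let $q$ be a prime power, let $n,m\ge 2$ be integers, and let $\mathcal{C}$ be an $\mathbb{F}_q$-$[n\times m,k,d]$ code. Let $1\le t<d$ be an integer, and assume that $$|\{1\le i\le n-t \ : \ W_i(\mathcal{C}^* )\neq 0\}|\le d-t.$$ Denote by $d^*$ the minimum distance of $\mathcal{C}^*$, and let $w,w^*$ be integers satisfying $d\le w\le n$ and $d^*\le w^*\le n$. Suppose that $\mathcal{C}$ (resp. $\mathcal{C}^*$) is $u$-invariant for each $u\le w$ (resp. $u\le w^*$). Then the $u$-supports of $\mathcal{C}$ (resp. $\mathcal{C}^*$) form the blocks of a $t$-design over $\mathbb{F}_q$ for each $d\le u\le w$ (resp. $d^*\le u\le\min\{w^*,n-t\}$).
   Context: An $\mathbb{F}_q$-$[n\times m,k,d]$ code is an $\mathbb{F}_q$-linear subspace $\mathcal{C}\le\mathbb{F}_q^{n\times m}$ of $\mathbb{F}_q$-dimension $k$ with minimum (rank) distance $d=\min\{\mathrm{rk}(X): X\in\mathcal{C}, X\ne 0\}$. Its dual is $\mathcal{C}^*=\{Y\in\mathbb{F}_q^{n\times m}:\mathrm{Tr}(XY^\top)=0 \text{ for all } X\in\mathcal{C}\}$. $W_i(\mathcal{C})$ is the number of $X\in\mathcal{C}$ with $\mathrm{rk}(X)=i$. The support $\sigma(X)\le\mathbb{F}_q^n$ of a matrix $X\in\mathbb{F}_q^{n\times m}$ is its column space. For a subspace $U\le\mathbb{F}_q^n$ let $\mathcal{C}_=(U)=\{X\in\mathcal{C}:\sigma(X)=U\}$. A $u$-dimensional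 subspace $U$ of $\mathbb{F}_q^n$ is a $u$-support of $\mathcal{C}$ if $\mathcal{C}_=(U)\ne\emptyset$. For an integer $u$ with $d\le u\le n$, where $d$ is the minimum distance of $\mathcal{C}$, the code $\mathcal{C}$ is $u$-invariant if $|\mathcal{C}_=(U)|$ depends only on $u$ for each $u$-support $U$ of $\mathcal{C}$. The same definitions apply to $\mathcal{C}^*$, with $d^*$ in place of $d$. For positive integers $n\ge r\ge t$, a collection $\mathcal{D}$ of $r$-dimensional subspaces of $\mathbb{F}_q^n$ forms the blocks of a $t$-design over $\mathbb{F}_q$ if every $t$-dimensional subspace of $\mathbb{F}_q^n$ is contained in the same number $\lambda$ of elements of $\mathcal{D}$. *)

theory Defs
  imports "HOL-Analysis.Analysis"
begin

text \<open>
  A matrix with \<open>n\<close> rows and \<open>m\<close> columns has type \<open>'a^'m^'n\<close>, where \<open>n = CARD('n)\<close>,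
  \<open>m = CARD('m)\<close>. On this type \<open>(*s)\<close> would take scalars from \<open>'a^'m\<close>, so scalar
  multiplication by field elements is introduced separately.
\<close>

definition mat_scale :: "'a::field \<Rightarrow> 'a^'m^'n \<Rightarrow> 'a^'m^'n"
  where "mat_scale c X = (\<chi> i j. c * X $ i $ j)"

interpretation mat: vector_space mat_scale
  by unfold_locales (simp_all add: mat_scale_def vec_eq_iff algebra_simps)

text \<open>Meaningful only if \<open>C\<close> has a nonzero element.\<close>

definition min_dist :: "('a::{field,finite}^'m^'n) set \<Rightarrow> nat"
  where "min_dist C = Min {rank X | X. X \<in> C \<and> X \<noteq> 0}"

definition rank_code :: "('a::{field,finite}^'m^'n) set \<Rightarrow> nat \<Rightarrow> nat \<Rightarrow> bool"
  where "rank_code C k d \<longleftrightarrow>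
    mat.subspace C \<and> mat.dim C = k \<and> (\<exists>X\<in>C. X \<noteq> 0) \<and> min_dist C = d"

definition dual_code :: "('a::{field,finite}^'m^'n) set \<Rightarrow> ('a^'m^'n) set"
  where "dual_code C = {Y. \<forall>X\<in>C. trace (X ** transpose Y) = 0}"

definition weight_count :: "('a::{field,finite}^'m^'n) set \<Rightarrow> nat \<Rightarrow> nat"
  where "weight_count C i = card {X \<in> C. rank X = i}"

definition supp :: "'a::{field,finite}^'m^'n \<Rightarrow> ('a^'n) set"
  where "supp X = vec.span (columns X)"

definition with_supp :: "('a::{field,finite}^'m^'n) set \<Rightarrow> ('a^'n) set \<Rightarrow> ('a^'m^'n) set"
  where "with_supp C U = {X \<in> C. supp X = U}"

definition supports :: "('a::{field,finite}^'m^'n) set \<Rightarrow> nat \<Rightarrow> ('a^'n) set set"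
  where "supports C u = {U. vec.subspace U \<and> vec.dim U = u \<and> with_supp C U \<noteq> {}}"

definition invariant :: "('a::{field,finite}^'m^'n) set \<Rightarrow> nat \<Rightarrow> bool"
  where "invariant C u \<longleftrightarrow>
    (\<forall>U\<in>supports C u. \<forall>V\<in>supports C u. card (with_supp C U) = card (with_supp C V))"

text \<open>
  The usual parameter range \<open>1 \<le> t \<le> r \<le> n\<close> is not part of the definition. For \<open>r < t\<close>
  the condition holds for every family of \<open>r\<close>-dimensional subspaces, with \<open>l = 0\<close>.
\<close>

definition subspace_design :: "nat \<Rightarrow> nat \<Rightarrow> ('a::{field,finite}^'n) set set \<Rightarrow> bool"
  where "subspace_design t r D \<longleftrightarrow>
    (\<forall>U\<in>D. vec.subspace U \<and> vec.dim U = r) \<and>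
    (\<exists>l. \<forall>T. vec.subspace T \<and> vec.dim T = t \<longrightarrow> card {U \<in> D. T \<subseteq> U} = l)"

end

theory Submission
  imports Defs "HOL-Computational_Algebra.Polynomial"
begin

text \<open>
  This is a rank-metric Assmus--Mattson theorem. Write \<open>q\<close> for the field size, \<open>n\<close> for the number of
  rows, and \<open>orth V\<close> for the orthogonal space of \<open>V\<close>. Since the code is \<open>u\<close>-invariant, the \<open>u\<close>-supports
  form a \<open>t\<close>-design as soon as the number of codewords of rank \<open>u\<close> whose support contains a subspace
  \<open>T\<close> of dimension \<open>t\<close> does not depend on \<open>T\<close> (\<open>subspace_design_supports\<close>). So it suffices to show this
  independence for \<open>C\<close> and for its dual.

  Two tools carry the proof. The first is duality: the number of codewords of \<open>C\<close> supported in \<open>V\<close>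
  determines the number of dual codewords supported in \<open>orth V\<close> (\<open>shortened_duality\<close>). The second is a
  moment argument: if a quantity takes at most \<open>N\<close> values on a finite family, its first \<open>N\<close> power sums
  determine its distribution. The quantity is always the size \<open>q ^ i\<close> of an intersection \<open>\<sigma> X \<inter> W\<close> of
  subspaces, and its \<open>j\<close>-th power counts \<open>j\<close>-tuples of vectors in that intersection, so that power sums
  become counts of the members of the family that contain a given tuple (\<open>dim_Int_counts_eq\<close>). These
  counts are compared for different \<open>W\<close> by a linear automorphism.

  Let \<open>T\<close> have dimension \<open>s \<le> t\<close>. A subspace of dimension less than \<open>d\<close> supports no nonzero
  codeword of \<open>C\<close>, so duality gives the first \<open>d - s\<close> moments for the dual code shortened to
  \<open>orth T\<close>. This code has at most \<open>d - s\<close> nonzero weights, hence its weight distribution is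
  independent of \<open>T\<close> (\<open>shortened_dual_weights\<close>). For the dual code this says that the spaces
  \<open>orth (supp Y)\<close>, for \<open>Y\<close> of rank \<open>u\<close>, contain every \<open>s\<close>-dimensional subspace equally often for
  all \<open>s \<le> t\<close>. The moment argument, applied to their intersections with \<open>orth T\<close>, then counts the \<open>Y\<close>
  with \<open>orth (supp Y) \<subseteq> orth T\<close>, that is, with \<open>T \<subseteq> supp Y\<close> (\<open>dual_code_counts_containing\<close>). For \<open>C\<close>,
  duality carries the weights of the shortened dual code to the distribution of \<open>dim (supp X + T)\<close>
  (\<open>dim_Int_orth_distribution\<close>), and an induction on the rank extracts from it the number of
  codewords of each rank whose support contains \<open>T\<close> (\<open>code_incidence_counts\<close>).
\<close>

section \<open>Orthogonal complements over a finite field\<close>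

text \<open>
  The first isomorphism theorem in counting form: the nonempty fibres of \<open>\<phi>\<close> are the cosets of \<open>K\<close>. It is
  stated through the fibres because one of its uses has \<open>\<phi>\<close> take values in the functions that are
  \<open>undefined\<close> outside a basis, which are not closed under addition.
\<close>

lemma card_UNIV_eq_kernel_times_range:
  fixes \<phi> :: "'x::{finite,ab_group_add} \<Rightarrow> 'y"
  assumes K: "\<And>x y. \<phi> x = \<phi> y \<longleftrightarrow> x - y \<in> K"
  shows "CARD('x) = card K * card (range \<phi>)"
proof -
  have fib: "card {x. \<phi> x = y} = card K" if y: "y \<in> range \<phi>" for y
  proof -
    obtain x0 where x0: "y = \<phi> x0" using y by blast
    have "{x. \<phi> x = y} = (\<lambda>z. z + x0) ` K"
    proof (intro set_eqI iffI)
      fix x assume "x \<in> {x. \<phi> x = y}"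
      then have "x - x0 \<in> K" using K x0 by auto
      then show "x \<in> (\<lambda>z. z + x0) ` K" by (intro image_eqI[of _ _ "x - x0"]) auto
    next
      fix x assume "x \<in> (\<lambda>z. z + x0) ` K"
      then show "x \<in> {x. \<phi> x = y}" using K x0 by auto
    qed
    then show ?thesis by (simp add: card_image inj_on_def)
  qed
  have "CARD('x) = (\<Sum>x\<in>(UNIV::'x set). 1)" by simp
  also have "\<dots> = (\<Sum>y\<in>range \<phi>. of_nat (card {x\<in>UNIV. \<phi> x = y}) * 1)"
    by (rule sum_fun_comp) auto
  also have "\<dots> = (\<Sum>y\<in>range \<phi>. card K)" by (intro sum.cong) (auto simp: fib)
  finally show ?thesis by simp
qed

lemma card_span_independent:
  fixes B :: "('a::{field,finite}^'k) set"
  assumes "vec.independent B"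
  shows "card (vec.span B) = CARD('a) ^ card B"
proof -
  have fB: "finite B" by simp
  let ?\<Phi> = "\<lambda>c. \<Sum>b\<in>B. c b *s b"
  have inj: "inj_on ?\<Phi> (B \<rightarrow>\<^sub>E UNIV)"
  proof (rule inj_onI)
    fix c c' :: "'a^'k \<Rightarrow> 'a"
    assume c: "c \<in> B \<rightarrow>\<^sub>E UNIV" and c': "c' \<in> B \<rightarrow>\<^sub>E UNIV" and eq: "?\<Phi> c = ?\<Phi> c'"
    have "(\<Sum>b\<in>B. (c b - c' b) *s b) = 0"
      using eq by (simp add: vec.scale_left_diff_distrib sum_subtractf)
    then have "\<forall>b\<in>B. c b - c' b = 0"
      using iffD1[OF vec.independent_explicit assms, THEN conjunct2, rule_format, of "\<lambda>b. c b - c' b"] by simp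
    then show "c = c'" using c c' by (intro PiE_ext) auto
  qed
  have img: "?\<Phi> ` (B \<rightarrow>\<^sub>E UNIV) = vec.span B"
  proof -
    have "?\<Phi> c \<in> ?\<Phi> ` (B \<rightarrow>\<^sub>E UNIV)" for c
      by (intro image_eqI[of _ _ "restrict c B"]) auto
    then show ?thesis unfolding vec.span_finite[OF fB] by auto
  qed
  have "card (vec.span B) = card (B \<rightarrow>\<^sub>E (UNIV :: 'a set))"
    using card_image[OF inj] img by simp
  also have "\<dots> = CARD('a) ^ card B" by (simp add: card_PiE[OF fB])
  finally show ?thesis .
qed

lemma card_subspace:
  fixes V :: "('a::{field,finite}^'k) set"
  assumes "vec.subspace V"
  shows "card V = CARD('a) ^ vec.dim V"
proof -
  obtain B where B: "B \<subseteq> V" "vec.independent B" "V \<subseteq> vec.span B" "card B = vec.dim V"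
    using vec.basis_exists by blast
  have "vec.span B = V" using B assms vec.span_subspace by blast
  then show ?thesis using card_span_independent[OF B(2)] B(4) by simp
qed

lemma card_field_gt_1: "CARD('a::{field,finite}) > 1"
proof -
  have "card {0, 1::'a} \<le> CARD('a)" by (rule card_mono) auto
  then show ?thesis by simp
qed

text \<open>
  Over a finite field this symmetric form may have nonzero isotropic vectors, so \<open>orth V\<close> need not be a
  complement of \<open>V\<close>; only its dimension is the expected one.
\<close>

definition dot :: "'a::field^'k \<Rightarrow> 'a^'k \<Rightarrow> 'a"
  where "dot x y = (\<Sum>i\<in>UNIV. x $ i * y $ i)"

definition orth :: "('a::field^'k) set \<Rightarrow> ('a^'k) set"
  where "orth A = {y. \<forall>x\<in>A. dot x y = 0}"

lemma dot_commute: "dot x y = dot y x"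
  by (simp add: dot_def mult.commute)

lemma dot_right: "dot x (y + z) = dot x y + dot x z" "dot x (c *s y) = c * dot x y"
  "dot x (y - z) = dot x y - dot x z" "dot x 0 = 0"
  by (simp_all add: dot_def algebra_simps sum.distrib sum_distrib_left sum_subtractf)

lemma subspace_orth: "vec.subspace (orth A)"
  by (auto simp: orth_def vec.subspace_def dot_right)

lemma subset_orth_iff: "A \<subseteq> orth B \<longleftrightarrow> B \<subseteq> orth A"
  unfolding orth_def subset_iff mem_Collect_eq Ball_def by (metis dot_commute)

lemma orth_span: "orth (vec.span A) = orth A"
proof
  show "orth (vec.span A) \<subseteq> orth A" using vec.span_superset by (auto simp: orth_def)
  have "A \<subseteq> orth (orth A)" using subset_orth_iff by blast
  then have "vec.span A \<subseteq> orth (orth A)" by (rule vec.span_minimal) (rule subspace_orth)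
  then show "orth A \<subseteq> orth (vec.span A)" using subset_orth_iff by blast
qed

lemma orth_Un: "orth (A \<union> B) = orth A \<inter> orth B"
  by (auto simp: orth_def)

text \<open>
  Nondegeneracy of the form: a functional prescribed on an independent set extends to the whole
  space, and its values on the standard basis are the coordinates of \<open>y\<close>.
\<close>

lemma exists_dot_prescribed:
  fixes B :: "('a::field^'k) set"
  assumes "vec.independent B"
  shows "\<exists>y. \<forall>b\<in>B. dot b y = g b"
proof -
  obtain F :: "'a^'k \<Rightarrow> 'a^'k" where F: "Vector_Spaces.linear (*s) (*s) F" "\<forall>b\<in>B. F b = (\<chi> j. g b)"
    using vec.linear_independent_extend[OF assms, of "\<lambda>b. \<chi> j. g b"] by blast
  \<comment> \<open>The functional is encoded as a map to constant vectors; any coordinate \<open>j0\<close> recovers it.\<close>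
  fix j0 :: 'k
  let ?y = "\<chi> i. F (axis i 1) $ j0"
  have "dot b ?y = F b $ j0" for b
    by (simp add: dot_def linear_componentwise[OF F(1), of b])
  then show ?thesis using F(2) by (intro exI[of _ ?y]) simp
qed

text \<open>
  Evaluating against a basis \<open>B\<close> of \<open>V\<close> maps the space onto all functions on \<open>B\<close>, with kernel
  \<open>orth V\<close>; comparing cardinalities compares exponents of \<open>q\<close>.
\<close>

lemma dim_orth:
  fixes V :: "('a::{field,finite}^'k) set"
  assumes V: "vec.subspace V"
  shows "vec.dim V + vec.dim (orth V) = CARD('k)"
proof -
  obtain B where B: "B \<subseteq> V" "vec.independent B" "V \<subseteq> vec.span B" "card B = vec.dim V"
    using vec.basis_exists by blast
  have sp: "vec.span B = V" using B V vec.span_subspace by blast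
  have fB: "finite B" by simp
  define \<phi> where "\<phi> y = (\<lambda>b\<in>B. dot b y)" for y :: "'a^'k"
  have "\<phi> x = \<phi> y \<longleftrightarrow> x - y \<in> orth B" for x y
    unfolding \<phi>_def orth_def by (auto simp: dot_right restrict_def fun_eq_iff)
  then have "CARD('a^'k) = card (orth B) * card (range \<phi>)"
    by (rule card_UNIV_eq_kernel_times_range)
  also have "range \<phi> = (B \<rightarrow>\<^sub>E UNIV)"
  proof
    show "range \<phi> \<subseteq> (B \<rightarrow>\<^sub>E UNIV)" by (auto simp: \<phi>_def)
    show "(B \<rightarrow>\<^sub>E UNIV) \<subseteq> range \<phi>"
    proof
      fix g :: "'a^'k \<Rightarrow> 'a" assume g: "g \<in> B \<rightarrow>\<^sub>E UNIV"
      obtain y where "\<forall>b\<in>B. dot b y = g b" using exists_dot_prescribed[OF B(2)] by blast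
      then have "\<phi> y = g" using g unfolding \<phi>_def by (intro PiE_ext[of _ B "\<lambda>_. UNIV"]) auto
      then show "g \<in> range \<phi>" by blast
    qed
  qed
  also have "card (B \<rightarrow>\<^sub>E (UNIV::'a set)) = CARD('a) ^ vec.dim V"
    by (simp add: card_PiE[OF fB] B(4))
  also have "orth B = orth V" using orth_span[of B] sp by simp
  also have "card (orth V) = CARD('a) ^ vec.dim (orth V)" by (rule card_subspace[OF subspace_orth])
  also have "CARD('a^'k) = CARD('a) ^ CARD('k)"
    using card_subspace[of "UNIV :: ('a^'k) set"] by (simp add: vec_dim_card)
  finally have "CARD('a) ^ CARD('k) = CARD('a) ^ (vec.dim V + vec.dim (orth V))"
    by (simp add: power_add mult.commute)
  then show ?thesis using card_field_gt_1[where 'a='a] by (metis power_inject_exp)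
qed

lemma orth_orth:
  fixes V :: "('a::{field,finite}^'k) set"
  assumes V: "vec.subspace V"
  shows "orth (orth V) = V"
proof -
  have "V \<subseteq> orth (orth V)" using subset_orth_iff by blast
  moreover have "vec.dim (orth (orth V)) \<le> vec.dim V"
    using dim_orth[OF V] dim_orth[OF subspace_orth, of V] by linarith
  ultimately show ?thesis
    using vec.subspace_dim_equal[OF V subspace_orth] by blast
qed

text \<open>
  Grassmann's formula for \<open>A + B\<close>, whose orthogonal space is \<open>orth A \<inter> orth B\<close>.
\<close>

lemma dim_Int_orth:
  fixes A B :: "('a::{field,finite}^'k) set"
  assumes A: "vec.subspace A" and B: "vec.subspace B"
  shows "vec.dim (A \<inter> B) + CARD('k) = vec.dim A + vec.dim B + vec.dim (orth A \<inter> orth B)"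
proof -
  let ?S = "{x + y |x y. x \<in> A \<and> y \<in> B}"
  have S: "?S = vec.span (A \<union> B)"
    unfolding vec.span_Un vec.span_eq_iff[THEN iffD2, OF A] vec.span_eq_iff[THEN iffD2, OF B] ..
  have "orth ?S = orth A \<inter> orth B" unfolding S orth_span orth_Un ..
  moreover have "vec.dim ?S + vec.dim (orth ?S) = CARD('k)"
    by (rule dim_orth) (simp add: S)
  moreover have "vec.dim ?S + vec.dim (A \<inter> B) = vec.dim A + vec.dim B"
    by (rule vec.dim_sums_Int[OF A B])
  ultimately show ?thesis by simp
qed

section \<open>Supports, shortened codes and their duality\<close>

lemma supp_eq_range: "supp X = range (\<lambda>v. X *v v)"
proof
  have "column j X \<in> range (\<lambda>v. X *v v)" for j
  proof -
    have "X *v axis j 1 = column j X"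
      by (simp add: vec_eq_iff matrix_vector_mult_def column_def axis_def if_distrib cong: if_cong)
    then show ?thesis by (metis rangeI)
  qed
  moreover have "vec.subspace (range (\<lambda>v. X *v v))"
    by (rule vec.subspace_image[OF vec.subspace_UNIV])
  ultimately show "supp X \<subseteq> range (\<lambda>v. X *v v)"
    unfolding supp_def by (intro vec.span_minimal) (auto simp: columns_def)
  have "v $ j *s column j X \<in> vec.span (columns X)" for v j
    by (intro vec.span_scale vec.span_base) (auto simp: columns_def)
  then show "range (\<lambda>v. X *v v) \<subseteq> supp X"
    unfolding supp_def matrix_mult_sum by (auto intro!: vec.span_sum)
qed

lemma subspace_supp: "vec.subspace (supp X)"
  by (simp add: supp_def)

text \<open>
  The rank is defined through the rows and the support through the columns. Row rank equals column
  rank because \<open>orth (rows X)\<close> is the kernel, and \<open>supp X\<close> the image, of multiplication by \<open>X\<close>.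
\<close>

lemma rank_eq_dim_supp:
  fixes X :: "'a::{field,finite}^'m^'n"
  shows "rank X = vec.dim (supp X)"
proof -
  have row: "(X *v v) $ i = dot (row i X) v" for v i
    by (simp add: matrix_vector_mult_def dot_def row_def)
  have "X *v x = X *v y \<longleftrightarrow> x - y \<in> orth (rows X)" for x y
    unfolding vec_eq_iff[of "X *v x"] row orth_def rows_def by (auto simp: dot_right)
  then have "CARD('a^'m) = card (orth (rows X)) * card (supp X)"
    unfolding supp_eq_range by (rule card_UNIV_eq_kernel_times_range)
  also have "orth (rows X) = orth (vec.span (rows X))" by (simp add: orth_span)
  also have "card \<dots> = CARD('a) ^ vec.dim (orth (vec.span (rows X)))"
    by (rule card_subspace[OF subspace_orth])
  also have "card (supp X) = CARD('a) ^ vec.dim (supp X)"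
    by (rule card_subspace[OF subspace_supp])
  also have "CARD('a^'m) = CARD('a) ^ CARD('m)"
    using card_subspace[of "UNIV :: ('a^'m) set"] by (simp add: vec_dim_card)
  finally have "CARD('a) ^ CARD('m) = CARD('a) ^ (vec.dim (orth (vec.span (rows X))) + vec.dim (supp X))"
    by (simp add: power_add)
  then have "CARD('m) = vec.dim (orth (vec.span (rows X))) + vec.dim (supp X)"
    using card_field_gt_1[where 'a='a] by (metis power_inject_exp)
  with dim_orth[of "vec.span (rows X)"] show ?thesis
    by (simp add: row_rank_def_gen)
qed

lemma supp_eq_0_iff: "supp X \<subseteq> {0} \<longleftrightarrow> X = 0"
proof
  assume "supp X \<subseteq> {0}"
  then have "column j X = 0" for j
    unfolding supp_def using vec.span_superset[of "columns X"] by (auto simp: columns_def)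
  then show "X = 0" by (simp add: vec_eq_iff column_def)
next
  assume "X = 0"
  then show "supp X \<subseteq> {0}" by (simp add: supp_eq_range image_subset_iff)
qed

definition shortened :: "('a::{field,finite}^'m^'n) set \<Rightarrow> ('a^'n) set \<Rightarrow> ('a^'m^'n) set"
  where "shortened C V = {X \<in> C. supp X \<subseteq> V}"

lemma supp_subset_iff:
  assumes "vec.subspace V"
  shows "supp X \<subseteq> V \<longleftrightarrow> (\<forall>j. column j X \<in> V)"
proof -
  have "supp X \<subseteq> V \<longleftrightarrow> columns X \<subseteq> V"
    unfolding supp_def using assms vec.span_minimal vec.span_superset by blast
  then show ?thesis by (auto simp: columns_def)
qed

lemma trace_eq_sum_dot:
  fixes X Y :: "'a::field^'m^'n"
  shows "trace (X ** transpose Y) = (\<Sum>j\<in>UNIV. dot (column j X) (column j Y))"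
proof -
  have "trace (X ** transpose Y) = (\<Sum>i\<in>UNIV. \<Sum>j\<in>UNIV. X $ i $ j * Y $ i $ j)"
    by (simp add: trace_def matrix_matrix_mult_def transpose_def)
  also have "\<dots> = (\<Sum>j\<in>UNIV. dot (column j X) (column j Y))"
    unfolding dot_def column_def by (subst sum.swap) simp
  finally show ?thesis .
qed

text \<open>
  The trace form is the sum of the forms of corresponding columns, and the columns of a matrix
  supported in \<open>V\<close> vary independently over \<open>V\<close>.
\<close>

lemma dual_code_shortened_UNIV:
  fixes V :: "('a::{field,finite}^'n) set"
  assumes V: "vec.subspace V"
  shows "dual_code (shortened UNIV V :: ('a^'m^'n) set) = shortened UNIV (orth V)"
proof (intro set_eqI iffI)
  fix Y :: "'a^'m^'n" assume Y: "Y \<in> dual_code (shortened UNIV V)"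
  have "dot x (column j Y) = 0" if x: "x \<in> V" for x j
  proof -
    define X :: "'a^'m^'n" where "X = (\<chi> i j'. if j' = j then x $ i else 0)"
    have col: "column j' X = (if j' = j then x else 0)" for j'
      by (simp add: X_def column_def vec_eq_iff)
    have "X \<in> shortened UNIV V"
      unfolding shortened_def using x vec.subspace_0[OF V] by (simp add: supp_subset_iff[OF V] col)
    then have "(\<Sum>j'\<in>UNIV. dot (column j' X) (column j' Y)) = 0"
      using Y by (simp add: dual_code_def trace_eq_sum_dot)
    moreover have "dot (column j' X) (column j' Y) = (if j' = j then dot x (column j Y) else 0)" for j'
      by (simp add: col dot_def)
    ultimately show ?thesis by simp
  qed
  then show "Y \<in> shortened UNIV (orth V)"
    unfolding shortened_def supp_subset_iff[OF subspace_orth] by (simp add: orth_def)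
next
  fix Y :: "'a^'m^'n" assume "Y \<in> shortened UNIV (orth V)"
  then show "Y \<in> dual_code (shortened UNIV V)"
    unfolding dual_code_def shortened_def mem_Collect_eq
      supp_subset_iff[OF subspace_orth] supp_subset_iff[OF V] trace_eq_sum_dot
    by (auto simp: orth_def intro!: sum.neutral)
qed

text \<open>
  Reading a matrix as one long vector turns the trace form into \<open>dot\<close>, so that the dimension formula
  for orthogonal spaces applies to codes.
\<close>

definition flat :: "'a^'m^'n \<Rightarrow> 'a^('n \<times> 'm)"
  where "flat X = (\<chi> p. X $ fst p $ snd p)"

lemma bij_flat: "bij flat"
proof (rule bijI')
  show "flat X = flat Y \<longleftrightarrow> X = Y" for X Y :: "'a^'m::finite^'n::finite"
    by (auto simp: flat_def vec_eq_iff)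
  show "\<exists>X. Z = flat X" for Z :: "'a^('n::finite \<times> 'm::finite)"
    by (intro exI[of _ "\<chi> i j. Z $ (i, j)"]) (simp add: flat_def vec_eq_iff)
qed

lemma dot_flat: "dot (flat X) (flat Y) = trace (X ** transpose Y)"
  by (simp add: dot_def flat_def trace_def matrix_matrix_mult_def transpose_def
      sum.cartesian_product UNIV_Times_UNIV split_def)

lemma subspace_flat:
  fixes C :: "('a::{field,finite}^'m^'n) set"
  assumes "mat.subspace C"
  shows "vec.subspace (flat ` C)"
proof -
  have flat: "0 = flat (0 :: 'a^'m^'n)" "flat X + flat Y = flat (X + Y)" "c *s flat X = flat (mat_scale c X)"
    for X Y :: "'a^'m^'n" and c
    by (simp_all add: flat_def mat_scale_def vec_eq_iff)
  show ?thesis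
    by (rule vec.subspaceI)
      (use assms in \<open>auto simp: flat intro: mat.subspace_0 mat.subspace_add mat.subspace_scale\<close>)
qed

lemma flat_dual_code: "flat ` dual_code C = orth (flat ` C)"
proof -
  have "orth (flat ` C) = flat ` {Y. \<forall>X\<in>C. dot (flat X) (flat Y) = 0}"
    unfolding orth_def using bij_is_surj[OF bij_flat] by (auto simp: image_iff surj_def)
  then show ?thesis by (simp add: dual_code_def dot_flat)
qed

lemma card_shortened_UNIV:
  fixes V :: "('a::{field,finite}^'n) set"
  assumes V: "vec.subspace V"
  shows "card (shortened UNIV V :: ('a^'m^'n) set) = CARD('a) ^ (CARD('m) * vec.dim V)"
proof -
  have "bij_betw (\<lambda>X j. column j X) (shortened UNIV V :: ('a^'m^'n) set) ((UNIV::'m set) \<rightarrow>\<^sub>E V)"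
  proof (rule bij_betw_imageI)
    show "inj_on (\<lambda>X j. column j X) (shortened UNIV V :: ('a^'m^'n) set)"
      by (auto simp: inj_on_def fun_eq_iff column_def vec_eq_iff)
    show "(\<lambda>X j. column j X) ` (shortened UNIV V :: ('a^'m^'n) set) = (UNIV \<rightarrow>\<^sub>E V)"
    proof (intro set_eqI iffI)
      fix f :: "'m \<Rightarrow> 'a^'n" assume f: "f \<in> UNIV \<rightarrow>\<^sub>E V"
      have "column j (\<chi> i j. f j $ i) = f j" for j by (simp add: column_def vec_eq_iff)
      then show "f \<in> (\<lambda>X j. column j X) ` (shortened UNIV V :: ('a^'m^'n) set)"
        using f by (intro image_eqI[of _ _ "\<chi> i j. f j $ i"])
          (auto simp: shortened_def supp_subset_iff[OF V])
    qed (auto simp: shortened_def supp_subset_iff[OF V])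
  qed
  then have "card (shortened UNIV V :: ('a^'m^'n) set) = card ((UNIV::'m set) \<rightarrow>\<^sub>E V)"
    by (rule bij_betw_same_card)
  then show ?thesis
    by (simp add: card_PiE card_subspace[OF V] power_mult[symmetric] mult.commute)
qed

lemma subspace_shortened:
  fixes C :: "('a::{field,finite}^'m^'n) set"
  assumes "mat.subspace C" "vec.subspace V"
  shows "mat.subspace (shortened C V)"
proof -
  have "column j (0 :: 'a^'m^'n) = 0" "column j (X + Y) = column j X + column j Y"
    "column j (mat_scale c X) = c *s column j X" for X Y :: "'a^'m^'n" and c j
    by (simp_all add: column_def mat_scale_def vec_eq_iff)
  then show ?thesis
    using assms unfolding shortened_def mat.subspace_def
    by (auto simp: supp_subset_iff[OF assms(2)] vec.subspace_def)
qed

text \<open>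
  The rank-metric MacWilliams identity in its subspace form: the number of codewords supported in \<open>V\<close>
  determines the number of dual codewords supported in \<open>orth V\<close>. It is the dimension formula for the
  intersection of \<open>C\<close> with the space of all matrices supported in \<open>V\<close>.
\<close>

lemma shortened_duality:
  fixes C :: "('a::{field,finite}^'m^'n) set"
  assumes C: "mat.subspace C" and V: "vec.subspace V"
  shows "card (shortened C V) * CARD('a) ^ (CARD('m) * CARD('n))
    = card C * CARD('a) ^ (CARD('m) * vec.dim V) * card (shortened (dual_code C) (orth V))"
proof -
  let ?F = "shortened UNIV V :: ('a^'m^'n) set"
  let ?q = "CARD('a)"
  have cf: "card (flat ` S) = card S" for S :: "('a^'m^'n) set"
    using inj_on_subset[OF bij_is_inj[OF bij_flat] subset_UNIV] by (rule card_image)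
  have fI: "flat ` S \<inter> flat ` T = flat ` (S \<inter> T)" for S T :: "('a^'m^'n) set"
    using image_Int[OF bij_is_inj[OF bij_flat]] by blast
  have F: "mat.subspace ?F" by (rule subspace_shortened[OF mat.subspace_UNIV V])
  have sC: "vec.subspace (flat ` C)" and sF: "vec.subspace (flat ` ?F)"
    by (rule subspace_flat, fact)+
  have I1: "flat ` C \<inter> flat ` ?F = flat ` shortened C V"
    unfolding fI by (rule arg_cong[of _ _ "image flat"]) (auto simp: shortened_def)
  have I2: "orth (flat ` C) \<inter> orth (flat ` ?F) = flat ` shortened (dual_code C) (orth V)"
    unfolding flat_dual_code[symmetric] fI dual_code_shortened_UNIV[OF V]
    by (rule arg_cong[of _ _ "image flat"]) (auto simp: shortened_def)
  have "?q ^ vec.dim (flat ` C \<inter> flat ` ?F) * ?q ^ CARD('n \<times> 'm)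
     = ?q ^ vec.dim (flat ` C) * ?q ^ vec.dim (flat ` ?F) * ?q ^ vec.dim (orth (flat ` C) \<inter> orth (flat ` ?F))"
    using dim_Int_orth[OF sC sF] by (simp add: power_add[symmetric])
  moreover have "?q ^ vec.dim (flat ` C \<inter> flat ` ?F) = card (shortened C V)"
    using card_subspace[OF vec.subspace_inter[OF sC sF]] by (simp add: I1 cf)
  moreover have "?q ^ vec.dim (flat ` C) = card C" "?q ^ vec.dim (flat ` ?F) = card ?F"
    using card_subspace[OF sC] card_subspace[OF sF] by (simp_all add: cf)
  moreover have "?q ^ vec.dim (orth (flat ` C) \<inter> orth (flat ` ?F)) = card (shortened (dual_code C) (orth V))"
    using card_subspace[OF vec.subspace_inter[OF subspace_orth subspace_orth], of "flat ` C" "flat ` ?F"]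
    by (simp add: I2 cf)
  ultimately show ?thesis
    using card_shortened_UNIV[OF V, where 'm='m] by (simp add: mult.commute)
qed

section \<open>Distributions determined by power moments\<close>

lemma sum_poly_eq_moments:
  fixes p :: "'a::comm_semiring_1 poly"
  shows "(\<Sum>x\<in>S. poly p (h x)) = (\<Sum>j\<le>degree p. coeff p j * (\<Sum>x\<in>S. h x ^ j))"
  unfolding poly_altdef sum_distrib_left by (rule sum.swap)

text \<open>
  A polynomial that vanishes at all possible values except \<open>e v\<close> reads off the frequency of \<open>v\<close>.
\<close>

lemma sum_poly_isolating:
  fixes e :: "'v \<Rightarrow> real"
  assumes "finite S" "h ` S \<subseteq> I" "\<And>i. i \<in> I \<Longrightarrow> i \<noteq> v \<Longrightarrow> poly p (e i) = 0"
  shows "(\<Sum>x\<in>S. poly p (e (h x))) = card {x\<in>S. h x = v} * poly p (e v)"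
proof -
  have "(\<Sum>x\<in>S. poly p (e (h x))) = (\<Sum>x\<in>S. if h x = v then poly p (e v) else 0)"
    using assms by (intro sum.cong refl) auto
  also have "\<dots> = card {x\<in>S. h x = v} * poly p (e v)"
    using assms by (simp add: sum.If_cases Int_def)
  finally show ?thesis .
qed

text \<open>
  Invertibility of the Vandermonde matrix: if at most \<open>N\<close> distinct values occur, the power sums of
  exponent less than \<open>N\<close> determine how often each value occurs, because the isolating polynomial has
  degree less than \<open>N\<close>.
\<close>

lemma counts_eq_if_moments_eq:
  fixes e :: "'v \<Rightarrow> real"
  assumes fin: "finite A" "finite B" "finite I" and vals: "f ` A \<subseteq> I" "g ` B \<subseteq> I"
    and inj: "inj_on e I" and card: "card I \<le> N"
    and mom: "\<And>j. j < N \<Longrightarrow> (\<Sum>a\<in>A. e (f a) ^ j) = (\<Sum>b\<in>B. e (g b) ^ j)"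
  shows "card {a\<in>A. f a = v} = card {b\<in>B. g b = v}"
proof (cases "v \<in> I")
  case False
  then have "{a\<in>A. f a = v} = {}" "{b\<in>B. g b = v} = {}" using vals by auto
  then show ?thesis by (simp only: card.empty)
next
  case True
  define p where "p = (\<Prod>i\<in>I-{v}. [:- e i, 1:])"
  have "degree p = card (I - {v})"
    unfolding p_def by (subst degree_prod_eq_sum_degree) auto
  then have deg: "degree p < N"
    using card_Diff1_less[OF fin(3) True] card by linarith
  have root: "poly p (e i) = 0" if "i \<in> I" "i \<noteq> v" for i
    unfolding p_def poly_prod using that fin by (intro prod_zero) auto
  have nz: "poly p (e v) \<noteq> 0"
    unfolding p_def poly_prod using fin True inj by (auto simp: inj_on_def)
  have "(\<Sum>a\<in>A. poly p (e (f a))) = (\<Sum>b\<in>B. poly p (e (g b)))"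
    unfolding sum_poly_eq_moments using deg by (intro sum.cong refl) (simp add: mom)
  then show ?thesis
    using sum_poly_isolating[of A f I v p e] sum_poly_isolating[of B g I v p e] fin vals root nz
    by simp
qed

text \<open>
  Exchanges sums over two codes with the same weight distribution (\<open>f\<close> and \<open>g\<close> being the rank)
  whose summands are given by different expressions but depend only on the rank.
\<close>

lemma sum_eq_if_counts_eq:
  fixes h k :: "_ \<Rightarrow> nat"
  assumes fin: "finite A" "finite B"
    and cnt: "\<And>i. card {a\<in>A. f a = i} = card {b\<in>B. g b = i}"
    and eq: "\<And>a b. a \<in> A \<Longrightarrow> b \<in> B \<Longrightarrow> f a = g b \<Longrightarrow> h a = k b"
  shows "sum h A = sum k B"
proof -
  have inner: "(\<Sum>a\<in>{a\<in>A. f a = i}. h a) = (\<Sum>b\<in>{b\<in>B. g b = i}. k b)" for i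
  proof (cases "{a\<in>A. f a = i} = {}")
    case True
    then have "card {b\<in>B. g b = i} = 0" using cnt[of i] by (simp only: card.empty)
    then have "{b\<in>B. g b = i} = {}" using fin by simp
    with True show ?thesis by (simp only: sum.empty)
  next
    case False
    then obtain a0 where a0: "a0 \<in> A" "f a0 = i" by blast
    have "card {b\<in>B. g b = i} \<noteq> 0" using a0 fin unfolding cnt[of i, symmetric] by auto
    then have "{b\<in>B. g b = i} \<noteq> {}" by (metis card.empty)
    then obtain b0 where b0: "b0 \<in> B" "g b0 = i" by blast
    have "(\<Sum>a\<in>{a\<in>A. f a = i}. h a) = (\<Sum>a\<in>{a\<in>A. f a = i}. k b0)"
      using eq b0 by (intro sum.cong) auto
    moreover have "(\<Sum>b\<in>{b\<in>B. g b = i}. k b) = (\<Sum>b\<in>{b\<in>B. g b = i}. h a0)"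
      using eq[OF a0(1)] a0(2) by (intro sum.cong) auto
    moreover have "h a0 = k b0" using eq a0 b0 by simp
    ultimately show ?thesis using cnt by simp
  qed
  let ?R = "f ` A \<union> g ` B"
  have "sum h A = (\<Sum>i\<in>?R. \<Sum>a\<in>{a\<in>A. f a = i}. h a)"
    using fin by (intro sum.group[symmetric]) auto
  also have "\<dots> = (\<Sum>i\<in>?R. \<Sum>b\<in>{b\<in>B. g b = i}. k b)" by (simp add: inner)
  also have "\<dots> = sum k B" using fin by (intro sum.group) auto
  finally show ?thesis .
qed

section \<open>Counting tuples of vectors in subspaces\<close>

text \<open>
  The general linear group acts transitively on flags \<open>A \<subseteq> W\<close> with given dimensions. This replaces
  explicit counting formulas: a count that depends only on the position of \<open>A\<close> in \<open>W\<close> depends only on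
  the two dimensions.
\<close>

lemma exists_flag_automorphism:
  fixes A W A' W' :: "('a::field^'k) set"
  assumes "vec.subspace A" "vec.subspace W" "A \<subseteq> W"
    and "vec.subspace A'" "vec.subspace W'" "A' \<subseteq> W'"
    and "vec.dim A = vec.dim A'" "vec.dim W = vec.dim W'"
  shows "\<exists>g. Vector_Spaces.linear (*s) (*s) g \<and> inj g \<and> g ` A = A' \<and> g ` W = W'"
proof -
  have flag_basis: "\<exists>B D. B \<subseteq> D \<and> vec.independent D \<and> vec.span B = S \<and> vec.span D = U \<and> finite D
      \<and> card B = vec.dim S \<and> card D = vec.dim U"
    if S: "vec.subspace S" and U: "vec.subspace U" and SU: "S \<subseteq> U" for S U :: "('a^'k) set"
  proof -
    obtain B where B: "B \<subseteq> S" "vec.independent B" "S \<subseteq> vec.span B"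
      using vec.maximal_independent_subset by blast
    obtain D where D: "B \<subseteq> D" "D \<subseteq> U" "vec.independent D" "U \<subseteq> vec.span D"
      using vec.maximal_independent_subset_extend[of B U] B SU by blast
    have "vec.span B = S" "vec.span D = U" using B D S U vec.span_subspace by blast+
    moreover have "card B = vec.dim S" "card D = vec.dim U"
      using vec.basis_card_eq_dim[of B S] vec.basis_card_eq_dim[of D U] B D by auto
    ultimately show ?thesis
      using D vec.finiteI_independent[of D] by (intro exI[of _ B] exI[of _ D]) auto
  qed
  from flag_basis[OF assms(1-3)] obtain B D where B: "B \<subseteq> D" "vec.independent D" "vec.span B = A" "vec.span D = W" "finite D"
      "card B = vec.dim A" "card D = vec.dim W"
    by auto
  from flag_basis[OF assms(4-6)] obtain B' D' where B': "B' \<subseteq> D'" "vec.independent D'" "vec.span B' = A'" "vec.span D' = W'" "finite D'"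
      "card B' = vec.dim A'" "card D' = vec.dim W'"
    by auto
  have fB: "finite B" "finite B'" using B B' finite_subset by blast+
  obtain h1 where h1: "bij_betw h1 B B'"
    using finite_same_card_bij[OF fB] B B' assms by auto
  have "card (D - B) = card (D' - B')"
    using B B' assms fB by (simp add: card_Diff_subset)
  then obtain h2 where h2: "bij_betw h2 (D - B) (D' - B')"
    using finite_same_card_bij[of "D - B" "D' - B'"] B B' by auto
  define h where "h x = (if x \<in> B then h1 x else h2 x)" for x
  have hB: "bij_betw h B B'" using h1 by (subst bij_betw_cong[of _ _ h1]) (auto simp: h_def)
  have "bij_betw h (D - B) (D' - B')" using h2 by (subst bij_betw_cong[of _ _ h2]) (auto simp: h_def)
  then have "bij_betw h (B \<union> (D - B)) (B' \<union> (D' - B'))"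
    by (intro bij_betw_combine hB) auto
  then have hD: "bij_betw h D D'" using B(1) B'(1) by (simp add: Un_absorb1)
  obtain g where g: "Vector_Spaces.linear (*s) (*s) g" "inj g" "\<forall>x\<in>D. g x = h x"
    using vec.linear_independent_extend_inj[of D h] B B' hD by (auto simp: bij_betw_def)
  have "g ` B = B'" "g ` D = D'"
  proof -
    have "g ` B = h ` B" "g ` D = h ` D" using g(3) B(1) by (auto intro!: image_cong)
    then show "g ` B = B'" "g ` D = D'" using hB hD by (auto simp: bij_betw_def)
  qed
  then have "g ` A = A'" "g ` W = W'"
    using B B' vec.linear_span_image[OF g(1), of B] vec.linear_span_image[OF g(1), of D] by simp_all
  then show ?thesis using g by blast
qed

text \<open>
  Repetitions are allowed, so that \<open>W\<close> has exactly \<open>card W ^ j\<close> tuples: this is what turns moments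
  into counts of incidences, without any Gaussian binomial coefficients.
\<close>

definition tuples :: "nat \<Rightarrow> 'b set \<Rightarrow> 'b list set"
  where "tuples j W = {xs. set xs \<subseteq> W \<and> length xs = j}"

lemma finite_tuples: "finite W \<Longrightarrow> finite (tuples j W)"
  by (simp add: tuples_def finite_lists_length_eq)

lemma sum_tuples_transport:
  assumes inj: "inj g" and gW: "g ` W = W'"
    and h: "\<And>xs. xs \<in> tuples j W \<Longrightarrow> h xs = h' (map g xs)"
  shows "(\<Sum>xs\<in>tuples j W. h xs) = (\<Sum>xs\<in>tuples j W'. h' xs)"
proof -
  have "tuples j W' = map g ` tuples j W"
  proof (intro set_eqI iffI)
    fix ys assume ys: "ys \<in> tuples j W'"
    have mem: "y \<in> g ` W" if "y \<in> set ys" for y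
      using ys that unfolding gW tuples_def by blast
    have "map g (map (inv_into W g) ys) = ys"
      unfolding map_map by (rule map_idI) (simp add: mem f_inv_into_f)
    moreover have "map (inv_into W g) ys \<in> tuples j W"
      using ys mem by (auto simp: tuples_def intro!: inv_into_into)
    ultimately show "ys \<in> map g ` tuples j W" by (metis imageI)
  qed (auto simp: tuples_def gW[symmetric] intro!: imageI)
  moreover have "inj_on (map g) (tuples j W)" using inj by (simp add: inj_on_def inj_map_eq_map)
  ultimately show ?thesis by (simp add: sum.reindex h)
qed

text \<open>
  Double counting of the pairs consisting of an object \<open>X\<close> and a \<open>j\<close>-tuple in \<open>\<sigma> X \<inter> W\<close>.
\<close>

lemma sum_card_Int_power:
  assumes "finite S" "finite W"
  shows "(\<Sum>X\<in>S. card (\<sigma> X \<inter> W) ^ j) = (\<Sum>xs\<in>tuples j W. card {X\<in>S. set xs \<subseteq> \<sigma> X})"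
proof -
  have "card (\<sigma> X \<inter> W) ^ j = card {xs\<in>tuples j W. set xs \<subseteq> \<sigma> X}" for X
  proof -
    have "card (\<sigma> X \<inter> W) ^ j = card {xs. set xs \<subseteq> \<sigma> X \<inter> W \<and> length xs = j}"
      by (rule card_lists_length_eq[symmetric]) (use assms in simp)
    moreover have "{xs. set xs \<subseteq> \<sigma> X \<inter> W \<and> length xs = j} = {xs\<in>tuples j W. set xs \<subseteq> \<sigma> X}"
      by (auto simp: tuples_def)
    ultimately show ?thesis by simp
  qed
  then have "(\<Sum>X\<in>S. card (\<sigma> X \<inter> W) ^ j) = (\<Sum>X\<in>S. \<Sum>xs | xs \<in> tuples j W \<and> set xs \<subseteq> \<sigma> X. 1)"
    by simp
  also have "\<dots> = (\<Sum>xs\<in>tuples j W. \<Sum>X | X \<in> S \<and> set xs \<subseteq> \<sigma> X. 1)"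
    using assms finite_tuples by (intro sum.swap_restrict) auto
  finally show ?thesis by simp
qed

text \<open>
  The moments of \<open>q ^ dim (\<sigma> X \<inter> W)\<close> are the sums in the last hypothesis; the powers of \<open>q\<close> serve as
  the distinct nodes.
\<close>

lemma dim_Int_counts_eq:
  fixes \<sigma> :: "'x \<Rightarrow> ('a::{field,finite}^'k) set"
  assumes fin: "finite S" "finite S'" "finite I"
    and \<sigma>: "\<And>X. vec.subspace (\<sigma> X)" and W: "vec.subspace W" "vec.subspace W'"
    and vals: "\<And>X. X \<in> S \<Longrightarrow> vec.dim (\<sigma> X \<inter> W) \<in> I" "\<And>X. X \<in> S' \<Longrightarrow> vec.dim (\<sigma> X \<inter> W') \<in> I"
    and card: "card I \<le> N"
    and mom: "\<And>j. j < N \<Longrightarrow> (\<Sum>xs\<in>tuples j W. card {X\<in>S. set xs \<subseteq> \<sigma> X})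
                          = (\<Sum>xs\<in>tuples j W'. card {X\<in>S'. set xs \<subseteq> \<sigma> X})"
  shows "card {X\<in>S. vec.dim (\<sigma> X \<inter> W) = i} = card {X\<in>S'. vec.dim (\<sigma> X \<inter> W') = i}"
proof (rule counts_eq_if_moments_eq[where I = I and N = N and e = "\<lambda>i. real (CARD('a) ^ i)"])
  show "inj_on (\<lambda>i. real (CARD('a) ^ i)) I"
    using card_field_gt_1[where 'a='a] by (auto simp: inj_on_def)
  fix j assume "j < N"
  have c: "CARD('a) ^ vec.dim (\<sigma> X \<inter> U) = card (\<sigma> X \<inter> U)" if "vec.subspace U" for X U
    using card_subspace[OF vec.subspace_inter[OF \<sigma> that]] by simp
  have "(\<Sum>X\<in>S. (CARD('a) ^ vec.dim (\<sigma> X \<inter> W)) ^ j) = (\<Sum>X\<in>S'. (CARD('a) ^ vec.dim (\<sigma> X \<inter> W')) ^ j)"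
    unfolding c[OF W(1)] c[OF W(2)] using mom[OF \<open>j < N\<close>] fin by (simp add: sum_card_Int_power)
  then show "(\<Sum>X\<in>S. real (CARD('a) ^ vec.dim (\<sigma> X \<inter> W)) ^ j) = (\<Sum>X\<in>S'. real (CARD('a) ^ vec.dim (\<sigma> X \<inter> W')) ^ j)"
    unfolding of_nat_power[symmetric] of_nat_sum[symmetric] by (simp only:)
next
  show "(\<lambda>X. vec.dim (\<sigma> X \<inter> W)) ` S \<subseteq> I" "(\<lambda>X. vec.dim (\<sigma> X \<inter> W')) ` S' \<subseteq> I"
    using vals by blast+
qed (fact fin card)+

text \<open>
  If any two subspaces of equal dimension at most \<open>s\<close> lie in equally many members of a family, then
  the family meets any two subspaces of equal dimension in the same way, provided that at most \<open>s + 1\<close> intersection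
  dimensions occur: a tuple of length at most \<open>s\<close> spans a subspace of dimension at most \<open>s\<close>.
\<close>

lemma dim_Int_counts_eq_if_homogeneous:
  fixes \<sigma> :: "'x \<Rightarrow> ('a::{field,finite}^'k) set"
  assumes fin: "finite S" "finite I"
    and \<sigma>: "\<And>X. vec.subspace (\<sigma> X)" and W: "vec.subspace W" "vec.subspace W'" "vec.dim W = vec.dim W'"
    and vals: "\<And>X. X \<in> S \<Longrightarrow> vec.dim (\<sigma> X \<inter> W) \<in> I" "\<And>X. X \<in> S \<Longrightarrow> vec.dim (\<sigma> X \<inter> W') \<in> I"
    and card: "card I \<le> s + 1"
    and hom: "\<And>A B. vec.subspace A \<Longrightarrow> vec.subspace B \<Longrightarrow> vec.dim A = vec.dim B \<Longrightarrow> vec.dim B \<le> s \<Longrightarrow>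
        card {X\<in>S. A \<subseteq> \<sigma> X} = card {X\<in>S. B \<subseteq> \<sigma> X}"
  shows "card {X\<in>S. vec.dim (\<sigma> X \<inter> W) = i} = card {X\<in>S. vec.dim (\<sigma> X \<inter> W') = i}"
proof (rule dim_Int_counts_eq[OF fin(1,1,2) \<sigma> W(1,2) vals card])
  fix j assume j: "j < s + 1"
  obtain g where g: "Vector_Spaces.linear (*s) (*s) g" "inj g" "g ` W = W'"
    using exists_flag_automorphism[of W W W' W'] W by auto
  have span: "set xs \<subseteq> \<sigma> X \<longleftrightarrow> vec.span (set xs) \<subseteq> \<sigma> X" for xs X
    using \<sigma> vec.span_minimal vec.span_superset by blast
  show "(\<Sum>xs\<in>tuples j W. card {X\<in>S. set xs \<subseteq> \<sigma> X}) = (\<Sum>xs\<in>tuples j W'. card {X\<in>S. set xs \<subseteq> \<sigma> X})"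
  proof (rule sum_tuples_transport[OF g(2,3)])
    fix xs assume xs: "xs \<in> tuples j W"
    have im: "vec.span (set (map g xs)) = g ` vec.span (set xs)"
      using vec.linear_span_image[OF g(1)] by simp
    have d: "vec.dim (g ` vec.span (set xs)) = vec.dim (vec.span (set xs))"
      using vec.dim_image_eq[OF g(1)] g(2) inj_on_subset by blast
    have "vec.dim (vec.span (set xs)) \<le> length xs"
      using vec.dim_le_card'[of "set xs"] card_length[of xs] by simp
    also have "length xs \<le> s" using xs j by (simp add: tuples_def)
    finally have le: "vec.dim (g ` vec.span (set xs)) \<le> s" by (simp only: d)
    have "vec.subspace (g ` vec.span (set xs))" unfolding im[symmetric] by (rule vec.subspace_span)
    with vec.subspace_span show "card {X\<in>S. set xs \<subseteq> \<sigma> X} = card {X\<in>S. set (map g xs) \<subseteq> \<sigma> X}"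
      unfolding span im by (rule hom[OF _ _ d[symmetric] le])
  qed
qed

section \<open>Codes whose dual has few weights\<close>

lemma dim_supp_Int:
  fixes T :: "('a::{field,finite}^'n) set" and X :: "'a^'m^'n"
  assumes "vec.subspace T"
  shows "vec.dim (supp X \<inter> T) + CARD('n) = rank X + vec.dim T + vec.dim (orth (supp X) \<inter> orth T)"
  using dim_Int_orth[OF subspace_supp assms] by (simp add: rank_eq_dim_supp)

lemma dim_orth_supp:
  fixes X :: "'a::{field,finite}^'m^'n"
  shows "rank X + vec.dim (orth (supp X)) = CARD('n)"
  using dim_orth[OF subspace_supp] by (simp add: rank_eq_dim_supp)

lemma rank_eq_0_iff:
  fixes X :: "'a::{field,finite}^'m^'n"
  shows "rank X = 0 \<longleftrightarrow> X = 0"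
  by (simp add: rank_eq_dim_supp supp_eq_0_iff)

lemma subset_supp_iff_dim:
  fixes T :: "('a::{field,finite}^'n) set" and X :: "'a^'m^'n"
  assumes T: "vec.subspace T"
  shows "T \<subseteq> supp X \<longleftrightarrow> vec.dim (supp X \<inter> T) = vec.dim T"
proof
  assume "T \<subseteq> supp X"
  then show "vec.dim (supp X \<inter> T) = vec.dim T" by (simp add: Int_absorb1)
next
  assume "vec.dim (supp X \<inter> T) = vec.dim T"
  then have "supp X \<inter> T = T"
    by (intro vec.subspace_dim_equal vec.subspace_inter subspace_supp T) auto
  then show "T \<subseteq> supp X" by blast
qed

text \<open>
  The hypotheses that do not concern invariance. Under them, in \<open>C\<close> and in its dual, every
  \<open>t\<close>-dimensional subspace lies in the supports of equally many codewords of each rank.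
\<close>

locale few_dual_weights =
  fixes C :: "('a::{field,finite}^'m^'n) set" and d t :: nat
  assumes subspace_C: "mat.subspace C"
    and rank_ge: "\<And>X. X \<in> C \<Longrightarrow> X \<noteq> 0 \<Longrightarrow> d \<le> rank X"
    and t_less_d: "t < d"
    and few: "card {i \<in> {1..CARD('n) - t}. weight_count (dual_code C) i \<noteq> 0} \<le> d - t"
begin

text \<open>
  The weight condition descends from \<open>t\<close> to every \<open>s \<le> t\<close>, since passing from \<open>n - t\<close> to \<open>n - s\<close>
  admits at most \<open>t - s\<close> new weights. All counts below are therefore available for every \<open>s \<le> t\<close>,
  which the moment arguments need.
\<close>

lemma few_weights_below:
  assumes "s \<le> t"
  shows "card {i \<in> {1..CARD('n) - s}. weight_count (dual_code C) i \<noteq> 0} \<le> d - s"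
proof -
  let ?W = "\<lambda>k. {i \<in> {1..k}. weight_count (dual_code C) i \<noteq> 0}"
  have "card (?W (CARD('n) - s)) \<le> card (?W (CARD('n) - t) \<union> {CARD('n) - t<..CARD('n) - s})"
    by (intro card_mono) auto
  also have "\<dots> \<le> card (?W (CARD('n) - t)) + card {CARD('n) - t<..CARD('n) - s}"
    by (rule card_Un_le)
  also have "\<dots> \<le> (d - t) + (t - s)" using few by (intro add_mono) auto
  finally show ?thesis using assms t_less_d by simp
qed

lemma shortened_C_trivial:
  assumes "vec.subspace V" "vec.dim V < d"
  shows "shortened C V = {0}"
proof -
  have "X = 0" if "X \<in> C" "supp X \<subseteq> V" for X
    using rank_ge[OF that(1)] vec.dim_subset[OF that(2)] assms(2) by (fastforce simp: rank_eq_dim_supp)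
  moreover have "supp (0 :: 'a^'m^'n) \<subseteq> V"
    using supp_eq_0_iff[of 0] vec.subspace_0[OF assms(1)] by blast
  ultimately show ?thesis
    unfolding shortened_def using mat.subspace_0[OF subspace_C] by blast
qed

text \<open>
  Below the minimum distance \<open>C\<close> has only the zero codeword supported in \<open>V\<close>, so duality determines
  the size of the dual code shortened to \<open>orth V\<close>.
\<close>

lemma card_shortened_dual:
  assumes V: "vec.subspace V" "vec.subspace V'" "vec.dim V = vec.dim V'" and "vec.dim V < d"
  shows "card (shortened (dual_code C) (orth V)) = card (shortened (dual_code C) (orth V'))"
proof -
  have "card C \<noteq> 0" using mat.subspace_0[OF subspace_C] by auto
  then show ?thesis
    using shortened_duality[OF subspace_C V(1)] shortened_duality[OF subspace_C V(2)]
      shortened_C_trivial[OF V(1)] shortened_C_trivial[OF V(2)] assms by simp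
qed

text \<open>
  For a tuple \<open>xs\<close> of length less than \<open>d - s\<close> the span of \<open>T\<close> and \<open>xs\<close> has dimension less than \<open>d\<close>,
  so the number of dual codewords with support orthogonal to both is known. This gives the first
  \<open>d - s\<close> moments of \<open>q ^ (n - rank Y)\<close>, at least as many as there are possible nonzero weights.
\<close>

lemma shortened_dual_weights:
  fixes T T' :: "('a^'n) set"
  assumes T: "vec.subspace T" "vec.dim T = s" and T': "vec.subspace T'" "vec.dim T' = s"
    and s: "s \<le> t"
  shows "card {Y \<in> shortened (dual_code C) (orth T). rank Y = i}
    = card {Y \<in> shortened (dual_code C) (orth T'). rank Y = i}"
proof -
  \<comment> \<open>The zero codeword is split off: its weight \<open>0\<close> could be one value too many for \<open>d - s\<close> moments.\<close>
  let ?S = "\<lambda>T. shortened (dual_code C) (orth T) - {0}"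
  let ?\<sigma> = "\<lambda>Y :: 'a^'m^'n. orth (supp Y)"
  let ?I = "(\<lambda>i. CARD('n) - i) ` {i \<in> {1..CARD('n) - s}. weight_count (dual_code C) i \<noteq> 0}"
  have zero: "0 \<in> shortened (dual_code C) (orth U)" for U :: "('a^'n) set"
    using supp_eq_0_iff[of "0 :: 'a^'m^'n"] vec.subspace_0[OF subspace_orth[of U]]
    by (auto simp: shortened_def dual_code_def trace_eq_sum_dot dot_def column_def)
  have vals: "vec.dim (?\<sigma> Y \<inter> UNIV) \<in> ?I" if Y: "Y \<in> ?S U" and U: "vec.subspace U" "vec.dim U = s" for Y U
  proof -
    have "rank Y \<noteq> 0"
      using Y by (simp add: rank_eq_0_iff)
    moreover have "rank Y + s \<le> CARD('n)"
      using Y vec.dim_subset[of "supp Y" "orth U"] dim_orth[OF U(1)] U(2)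
      by (auto simp: shortened_def rank_eq_dim_supp)
    moreover have "weight_count (dual_code C) (rank Y) \<noteq> 0"
      using Y by (auto simp: weight_count_def shortened_def)
    ultimately show ?thesis
      using dim_orth_supp[of Y] by (intro image_eqI[of _ _ "rank Y"]) auto
  qed
  have "card ?I \<le> d - s"
    by (rule order_trans[OF card_image_le few_weights_below[OF s]]) simp
  obtain g where g: "Vector_Spaces.linear (*s) (*s) g" "inj g" "g ` T = T'"
    using exists_flag_automorphism[of T UNIV T' UNIV] T T' by auto
  have counts: "card {Y\<in>?S T. vec.dim (?\<sigma> Y \<inter> UNIV) = v} = card {Y\<in>?S T'. vec.dim (?\<sigma> Y \<inter> UNIV) = v}" for v
  proof (rule dim_Int_counts_eq[where I = ?I and N = "d - s"])
    fix j assume j: "j < d - s"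
    show "(\<Sum>xs\<in>tuples j UNIV. card {Y\<in>?S T. set xs \<subseteq> ?\<sigma> Y}) = (\<Sum>xs\<in>tuples j UNIV. card {Y\<in>?S T'. set xs \<subseteq> ?\<sigma> Y})"
    proof (rule sum_tuples_transport[OF g(2) bij_is_surj])
      show "bij g"
        using vec.linear_inj_imp_surj[OF g(1,2)] g(2) by (rule bijI[rotated])
      fix xs :: "('a^'n) list" assume xs: "xs \<in> tuples j UNIV"
      have im: "vec.span (T' \<union> set (map g xs)) = g ` vec.span (T \<union> set xs)"
        using vec.linear_span_image[OF g(1), of "T \<union> set xs"] g(3) by (simp add: image_Un)
      have dim: "vec.dim (vec.span (T' \<union> set (map g xs))) = vec.dim (vec.span (T \<union> set xs))"
        unfolding im using vec.dim_image_eq[OF g(1)] g(2) inj_on_subset by blast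
      have less: "vec.dim (vec.span (T \<union> set xs)) < d"
      proof -
        obtain B where B: "B \<subseteq> T" "T \<subseteq> vec.span B" "card B = s"
          using vec.basis_exists[of T] T(2) by metis
        have "T \<subseteq> vec.span (B \<union> set xs)" using B(2) vec.span_mono[of B "B \<union> set xs"] by blast
        then have "T \<union> set xs \<subseteq> vec.span (B \<union> set xs)" using vec.span_superset by blast
        then have "vec.dim (T \<union> set xs) \<le> card (B \<union> set xs)" by (rule vec.dim_le_card) simp
        also have "\<dots> \<le> card B + card (set xs)" by (rule card_Un_le)
        also have "\<dots> \<le> s + j" using B(3) card_length[of xs] xs by (simp add: tuples_def)
        finally show ?thesis using j by simp
      qed
      have eq: "{Y\<in>?S U. set ys \<subseteq> ?\<sigma> Y} = shortened (dual_code C) (orth (vec.span (U \<union> set ys))) - {0}"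
        for U and ys :: "('a^'n) list"
        by (auto simp: shortened_def orth_span orth_Un subset_orth_iff[of "set ys"])
      show "card {Y\<in>?S T. set xs \<subseteq> ?\<sigma> Y} = card {Y\<in>?S T'. set (map g xs) \<subseteq> ?\<sigma> Y}"
        unfolding eq card_Diff_singleton[OF zero]
        using card_shortened_dual[OF vec.subspace_span vec.subspace_span dim[symmetric] less] by simp
    qed
  next
    show "card ?I \<le> d - s" by fact
  qed (use vals T T' in \<open>simp_all add: subspace_orth\<close>)
  show ?thesis
  proof (cases "i = 0")
    case True
    have "{Y \<in> shortened (dual_code C) (orth U). rank Y = 0} = {0}" for U
      using zero[of U] by (auto simp: rank_eq_0_iff)
    with True show ?thesis by simp
  next
    case False
    have "{Y \<in> shortened (dual_code C) (orth U). rank Y = i} =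
        (if i \<le> CARD('n) then {Y\<in>?S U. vec.dim (?\<sigma> Y \<inter> UNIV) = CARD('n) - i} else {})" for U
    proof -
      have "rank Y = i \<longleftrightarrow> i \<le> CARD('n) \<and> Y \<noteq> 0 \<and> vec.dim (?\<sigma> Y) = CARD('n) - i" for Y :: "'a^'m^'n"
        using dim_orth_supp[of Y] False rank_eq_0_iff[of Y] by auto
      then show ?thesis by auto
    qed
    then show ?thesis using counts by simp
  qed
qed

text \<open>
  The shortened dual codes count the \<open>Y\<close> with \<open>A \<subseteq> orth (supp Y)\<close>, so the family of the spaces
  \<open>orth (supp Y)\<close> is homogeneous. The condition \<open>T \<subseteq> supp Y\<close> means
  \<open>orth (supp Y) \<subseteq> orth T\<close>: the two spaces meet in dimension \<open>n - u\<close>, the largest one possible. Since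
  \<open>orth T\<close> has codimension \<open>s\<close>, at most \<open>s + 1\<close> dimensions occur, few enough for homogeneity in
  dimensions up to \<open>s\<close> to determine their frequencies.
\<close>

lemma dual_code_counts_containing:
  fixes T T' :: "('a^'n) set"
  assumes T: "vec.subspace T" "vec.dim T = s" and T': "vec.subspace T'" "vec.dim T' = s"
    and s: "s \<le> t"
  shows "card {Y \<in> dual_code C. rank Y = u \<and> T \<subseteq> supp Y} = card {Y \<in> dual_code C. rank Y = u \<and> T' \<subseteq> supp Y}"
proof -
  let ?S = "{Y \<in> dual_code C. rank Y = u}"
  let ?\<sigma> = "\<lambda>Y :: 'a^'m^'n. orth (supp Y)"
  \<comment> \<open>Here \<open>i\<close> stands for \<open>dim (supp Y \<inter> T)\<close>, which fixes the dimension of the orthogonal intersection.\<close>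
  let ?I = "(\<lambda>i. CARD('n) + i - (u + s)) ` {0..s}"
  have vals: "vec.dim (?\<sigma> Y \<inter> orth U) \<in> ?I"
    if "Y \<in> ?S" "vec.subspace U" "vec.dim U = s" for Y U
  proof -
    have "vec.dim (supp Y \<inter> U) \<le> s" using vec.dim_subset[of "supp Y \<inter> U" U] that by simp
    then show ?thesis
      using dim_supp_Int[OF that(2), of Y] that
      by (intro image_eqI[of _ _ "vec.dim (supp Y \<inter> U)"]) auto
  qed
  have dims: "vec.dim (orth T) = vec.dim (orth T')"
    using dim_orth[OF T(1)] dim_orth[OF T'(1)] T T' by simp
  have "card ?I \<le> s + 1" using card_image_le[of "{0..s}"] by fastforce
  have "card {Y\<in>?S. vec.dim (?\<sigma> Y \<inter> orth T) = CARD('n) - u} = card {Y\<in>?S. vec.dim (?\<sigma> Y \<inter> orth T') = CARD('n) - u}"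
  proof (rule dim_Int_counts_eq_if_homogeneous[where I = ?I and s = s])
    fix A B :: "('a^'n) set"
    assume AB: "vec.subspace A" "vec.subspace B" "vec.dim A = vec.dim B" "vec.dim B \<le> s"
    have "{Y\<in>?S. U \<subseteq> ?\<sigma> Y} = {Y \<in> shortened (dual_code C) (orth U). rank Y = u}" for U
      by (auto simp: shortened_def subset_orth_iff[of U])
    then show "card {Y\<in>?S. A \<subseteq> ?\<sigma> Y} = card {Y\<in>?S. B \<subseteq> ?\<sigma> Y}"
      using shortened_dual_weights[OF AB(1,3,2) refl] AB(4) s by simp
  qed (use vals T T' dims \<open>card ?I \<le> s + 1\<close> in \<open>simp_all add: subspace_orth\<close>)
  moreover have "{Y\<in>?S. vec.dim (?\<sigma> Y \<inter> orth U) = CARD('n) - u} = {Y \<in> dual_code C. rank Y = u \<and> U \<subseteq> supp Y}"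
    if "vec.subspace U" "vec.dim U = s" for U
  proof -
    have "vec.dim (?\<sigma> Y \<inter> orth U) = CARD('n) - u \<longleftrightarrow> U \<subseteq> supp Y" if "rank Y = u" for Y :: "'a^'m^'n"
      unfolding subset_supp_iff_dim[OF \<open>vec.subspace U\<close>]
      using dim_supp_Int[OF \<open>vec.subspace U\<close>, of Y] dim_orth_supp[of Y] that \<open>vec.dim U = s\<close> by linarith
    then show ?thesis by auto
  qed
  ultimately show ?thesis using T T' by simp
qed

text \<open>
  Puncturing \<open>C\<close> at \<open>T\<close> gives \<open>X\<close> the weight \<open>dim (supp X + T) - s\<close>, and \<open>dim (supp X + T)\<close> equals
  \<open>n - dim (orth (supp X) \<inter> orth T)\<close>. The punctured code is dual to the dual code shortened to \<open>orth T\<close>,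
  whose weight distribution is independent of \<open>T\<close>. In moments: by duality, the codewords orthogonal to a tuple \<open>xs\<close>
  in \<open>orth T\<close> are counted by the dual codewords with support in the span of \<open>xs\<close>, and after exchanging
  the sums the contribution of a dual codeword depends only on its rank.
\<close>

lemma dim_Int_orth_distribution:
  fixes T T' :: "('a^'n) set"
  assumes T: "vec.subspace T" "vec.dim T = s" and T': "vec.subspace T'" "vec.dim T' = s"
    and s: "s \<le> t"
  shows "card {X \<in> C. vec.dim (orth (supp X) \<inter> orth T) = i} = card {X \<in> C. vec.dim (orth (supp X) \<inter> orth T') = i}"
  \<comment> \<open>All moments agree, so it is harmless to allow every dimension from \<open>0\<close> to \<open>n\<close>.\<close>
proof (rule dim_Int_counts_eq[where I = "{0..CARD('n)}" and N = "CARD('n) + 1"])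
  fix j :: nat
  let ?q = "CARD('a)" and ?m = "CARD('m)"
  let ?D = "\<lambda>U. shortened (dual_code C) (orth U)"
  let ?h = "\<lambda>xs. ?q ^ (?m * vec.dim (orth (vec.span (set xs))))"
  have sum: "(\<Sum>xs\<in>tuples j (orth U). card {X\<in>C. set xs \<subseteq> orth (supp X)}) * ?q ^ (?m * CARD('n))
      = card C * (\<Sum>Y\<in>?D U. \<Sum>xs | xs \<in> tuples j (orth U) \<and> supp Y \<subseteq> vec.span (set xs). ?h xs)" for U
  proof -
    have "card {X\<in>C. set xs \<subseteq> orth (supp X)} * ?q ^ (?m * CARD('n))
       = card C * (\<Sum>Y | Y \<in> ?D U \<and> supp Y \<subseteq> vec.span (set xs). ?h xs)"
      if xs: "xs \<in> tuples j (orth U)" for xs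
    proof -
      have "{X\<in>C. set xs \<subseteq> orth (supp X)} = shortened C (orth (vec.span (set xs)))"
        unfolding shortened_def orth_span subset_orth_iff[of "set xs"] ..
      moreover have "vec.span (set xs) \<subseteq> orth U"
        using xs by (intro vec.span_minimal subspace_orth) (simp add: tuples_def)
      then have "shortened (dual_code C) (orth (orth (vec.span (set xs)))) = {Y \<in> ?D U. supp Y \<subseteq> vec.span (set xs)}"
        unfolding orth_orth[OF vec.subspace_span] by (auto simp: shortened_def)
      ultimately show ?thesis
        using shortened_duality[OF subspace_C subspace_orth, of "vec.span (set xs)"] by (simp add: mult.assoc)
    qed
    then have "(\<Sum>xs\<in>tuples j (orth U). card {X\<in>C. set xs \<subseteq> orth (supp X)}) * ?q ^ (?m * CARD('n))
      = (\<Sum>xs\<in>tuples j (orth U). card C * (\<Sum>Y | Y \<in> ?D U \<and> supp Y \<subseteq> vec.span (set xs). ?h xs))"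
      unfolding sum_distrib_right by (intro sum.cong refl)
    also have "\<dots> = card C * (\<Sum>Y\<in>?D U. \<Sum>xs | xs \<in> tuples j (orth U) \<and> supp Y \<subseteq> vec.span (set xs). ?h xs)"
      unfolding sum_distrib_left[symmetric] by (subst sum.swap_restrict) (simp_all add: finite_tuples)
    finally show ?thesis .
  qed
  have "(\<Sum>Y\<in>?D T. \<Sum>xs | xs \<in> tuples j (orth T) \<and> supp Y \<subseteq> vec.span (set xs). ?h xs)
      = (\<Sum>Y\<in>?D T'. \<Sum>xs | xs \<in> tuples j (orth T') \<and> supp Y \<subseteq> vec.span (set xs). ?h xs)"
  proof (rule sum_eq_if_counts_eq[where f = rank and g = rank])
    show "card {Y \<in> ?D T. rank Y = i} = card {Y \<in> ?D T'. rank Y = i}" for i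
      by (rule shortened_dual_weights[OF T T' s])
    fix Y Y' assume Y: "Y \<in> ?D T" "Y' \<in> ?D T'" "rank Y = rank Y'"
    have "vec.dim (orth T) = vec.dim (orth T')"
      using dim_orth[OF T(1)] dim_orth[OF T'(1)] T T' by simp
    then obtain g where g: "Vector_Spaces.linear (*s) (*s) g" "inj g" "g ` supp Y = supp Y'" "g ` orth T = orth T'"
      using exists_flag_automorphism[of "supp Y" "orth T" "supp Y'" "orth T'"] Y
      by (auto simp: subspace_supp subspace_orth shortened_def rank_eq_dim_supp)
    have "(\<Sum>xs\<in>tuples j (orth T). if supp Y \<subseteq> vec.span (set xs) then ?h xs else 0)
      = (\<Sum>xs\<in>tuples j (orth T'). if supp Y' \<subseteq> vec.span (set xs) then ?h xs else 0)"
    proof (rule sum_tuples_transport[OF g(2,4)])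
      fix xs
      have im: "vec.span (set (map g xs)) = g ` vec.span (set xs)"
        using vec.linear_span_image[OF g(1)] by simp
      have "vec.dim (vec.span (set (map g xs))) = vec.dim (vec.span (set xs))"
        unfolding im using vec.dim_image_eq[OF g(1)] g(2) inj_on_subset by blast
      then have "vec.dim (orth (vec.span (set (map g xs)))) = vec.dim (orth (vec.span (set xs)))"
        using dim_orth[OF vec.subspace_span, of "set xs"] dim_orth[OF vec.subspace_span, of "set (map g xs)"]
        by linarith
      moreover have "supp Y' \<subseteq> vec.span (set (map g xs)) \<longleftrightarrow> supp Y \<subseteq> vec.span (set xs)"
        unfolding im g(3)[symmetric] using inj_image_subset_iff[OF g(2)] by blast
      ultimately show "(if supp Y \<subseteq> vec.span (set xs) then ?h xs else 0)
        = (if supp Y' \<subseteq> vec.span (set (map g xs)) then ?h (map g xs) else 0)" by (simp only:)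
    qed
    then show "(\<Sum>xs | xs \<in> tuples j (orth T) \<and> supp Y \<subseteq> vec.span (set xs). ?h xs)
      = (\<Sum>xs | xs \<in> tuples j (orth T') \<and> supp Y' \<subseteq> vec.span (set xs). ?h xs)"
      by (simp add: sum.inter_filter finite_tuples)
  qed simp_all
  then have "(\<Sum>xs\<in>tuples j (orth T). card {X\<in>C. set xs \<subseteq> orth (supp X)}) * ?q ^ (?m * CARD('n))
      = (\<Sum>xs\<in>tuples j (orth T'). card {X\<in>C. set xs \<subseteq> orth (supp X)}) * ?q ^ (?m * CARD('n))"
    unfolding sum by (simp only:)
  then show "(\<Sum>xs\<in>tuples j (orth T). card {X\<in>C. set xs \<subseteq> orth (supp X)})
      = (\<Sum>xs\<in>tuples j (orth T'). card {X\<in>C. set xs \<subseteq> orth (supp X)})"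
    by simp
qed (simp_all add: subspace_orth dim_subset_UNIV_cart_gen)

text \<open>
  Both claims are proved together by induction on \<open>r\<close>. The number of codewords with
  \<open>dim (supp X + T) = r\<close> is independent of \<open>T\<close>; they have rank at most \<open>r\<close>, and those of rank exactly \<open>r\<close> are the ones whose support
  contains \<open>T\<close>. Subtracting the codewords of smaller rank, classified by their intersection with \<open>T\<close>,
  gives the second claim for \<open>r\<close>; the first follows from the second for all dimensions up to \<open>dim T\<close>
  by the moment argument.
\<close>

lemma code_incidence_counts:
  assumes "vec.subspace T" "vec.subspace T'" "vec.dim T = vec.dim T'" "vec.dim T' \<le> t"
  shows "card {X \<in> C. rank X = r \<and> vec.dim (supp X \<inter> T) = i} = card {X \<in> C. rank X = r \<and> vec.dim (supp X \<inter> T') = i}"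
    and "card {X \<in> C. rank X = r \<and> T \<subseteq> supp X} = card {X \<in> C. rank X = r \<and> T' \<subseteq> supp X}"
proof -
  have contain: "card {X \<in> C. rank X = r \<and> A \<subseteq> supp X} = card {X \<in> C. rank X = r \<and> B \<subseteq> supp X}"
    if AB: "vec.subspace A" "vec.subspace B" "vec.dim A = vec.dim B" "vec.dim B \<le> t"
      and IH: "\<And>r' i. r' < r \<Longrightarrow> card {X \<in> C. rank X = r' \<and> vec.dim (supp X \<inter> A) = i}
        = card {X \<in> C. rank X = r' \<and> vec.dim (supp X \<inter> B) = i}"
    for r A B
  proof (cases "r \<le> CARD('n)")
    case False
    then have "rank X \<noteq> r" for X :: "'a^'m^'n"
      using dim_orth_supp[of X] by linarith
    then show ?thesis by simp
  next
    case True
    let ?s = "vec.dim B"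
    let ?A = "\<lambda>U. {X \<in> C. vec.dim (orth (supp X) \<inter> orth U) = CARD('n) - r}"
    \<comment> \<open>Where \<open>r > r' + s\<close> no codeword of rank \<open>r'\<close> contributes; the guard keeps \<open>r' + s - r\<close> from being truncated.\<close>
    have split: "card (?A U) = card {X \<in> C. rank X = r \<and> U \<subseteq> supp X}
        + (\<Sum>r'<r. if r \<le> r' + ?s then card {X \<in> C. rank X = r' \<and> vec.dim (supp X \<inter> U) = r' + ?s - r} else 0)"
      if U: "vec.subspace U" "vec.dim U = ?s" for U
    proof -
      have eq: "vec.dim (orth (supp X) \<inter> orth U) = CARD('n) - r \<longleftrightarrow> vec.dim (supp X \<inter> U) + r = rank X + ?s"
        for X :: "'a^'m^'n"
        using dim_supp_Int[OF U(1), of X] True U(2) by linarith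
      have le: "vec.dim (supp X \<inter> U) \<le> ?s" for X :: "'a^'m^'n"
        using vec.dim_subset[of "supp X \<inter> U" U] U(2) by simp
      have "rank X \<le> r" if "X \<in> ?A U" for X using that le[of X] unfolding eq by simp
      then have "(\<Sum>X\<in>?A U. 1) = (\<Sum>r'\<le>r. of_nat (card {X \<in> ?A U. rank X = r'}) * (1::nat))"
        by (intro sum_fun_comp) auto
      then have "card (?A U) = (\<Sum>r'\<le>r. card {X \<in> ?A U. rank X = r'})" by simp
      also have "\<dots> = card {X \<in> ?A U. rank X = r} + (\<Sum>r'<r. card {X \<in> ?A U. rank X = r'})"
        unfolding lessThan_Suc_atMost[symmetric] by simp
      also have "{X \<in> ?A U. rank X = r} = {X \<in> C. rank X = r \<and> U \<subseteq> supp X}"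
        unfolding eq subset_supp_iff_dim[OF U(1)] U(2) by auto
      also have "(\<Sum>r'<r. card {X \<in> ?A U. rank X = r'})
        = (\<Sum>r'<r. if r \<le> r' + ?s then card {X \<in> C. rank X = r' \<and> vec.dim (supp X \<inter> U) = r' + ?s - r} else 0)"
      proof (intro sum.cong refl)
        fix r'
        have "{X \<in> ?A U. rank X = r'} = (if r \<le> r' + ?s then {X \<in> C. rank X = r' \<and> vec.dim (supp X \<inter> U) = r' + ?s - r} else {})"
          unfolding eq by auto
        then show "card {X \<in> ?A U. rank X = r'}
          = (if r \<le> r' + ?s then card {X \<in> C. rank X = r' \<and> vec.dim (supp X \<inter> U) = r' + ?s - r} else 0)"
          by simp
      qed
      finally show ?thesis .
    qed
    have "card (?A A) = card (?A B)"
      by (rule dim_Int_orth_distribution[OF AB(1,3,2) refl AB(4)])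
    moreover have "(\<Sum>r'<r. if r \<le> r' + ?s then card {X \<in> C. rank X = r' \<and> vec.dim (supp X \<inter> A) = r' + ?s - r} else 0)
        = (\<Sum>r'<r. if r \<le> r' + ?s then card {X \<in> C. rank X = r' \<and> vec.dim (supp X \<inter> B) = r' + ?s - r} else 0)"
      by (intro sum.cong refl if_cong IH) simp
    ultimately show ?thesis
      unfolding split[OF AB(1,3)] split[OF AB(2) refl] by linarith
  qed
  have dist: "card {X \<in> C. rank X = r \<and> vec.dim (supp X \<inter> A) = i} = card {X \<in> C. rank X = r \<and> vec.dim (supp X \<inter> B) = i}"
    if "vec.subspace A" "vec.subspace B" "vec.dim A = vec.dim B" "vec.dim B \<le> t" for r i A B
    using that
  proof (induction r arbitrary: A B i rule: less_induct)
    case (less r)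
    have "card {X \<in> {X\<in>C. rank X = r}. vec.dim (supp X \<inter> A) = i} = card {X \<in> {X\<in>C. rank X = r}. vec.dim (supp X \<inter> B) = i}"
    proof (rule dim_Int_counts_eq_if_homogeneous[where I = "{0..vec.dim B}" and s = "vec.dim B"])
      fix A' B' :: "('a^'n) set"
      assume AB': "vec.subspace A'" "vec.subspace B'" "vec.dim A' = vec.dim B'" "vec.dim B' \<le> vec.dim B"
      have "vec.dim B' \<le> t" using AB'(4) less.prems(4) by simp
      then show "card {X \<in> {X\<in>C. rank X = r}. A' \<subseteq> supp X} = card {X \<in> {X\<in>C. rank X = r}. B' \<subseteq> supp X}"
        using contain[OF AB'(1-3) _ less.IH[OF _ AB'(1-3)]] by simp
    next
      show "vec.dim (supp X \<inter> A) \<in> {0..vec.dim B}" "vec.dim (supp X \<inter> B) \<in> {0..vec.dim B}"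
        for X :: "'a^'m^'n"
        using vec.dim_subset[of "supp X \<inter> A" A] vec.dim_subset[of "supp X \<inter> B" B] less.prems(3) by auto
    qed (simp_all add: less.prems(1-3) subspace_supp)
    then show ?case by simp
  qed
  show "card {X \<in> C. rank X = r \<and> vec.dim (supp X \<inter> T) = i} = card {X \<in> C. rank X = r \<and> vec.dim (supp X \<inter> T') = i}"
    by (rule dist) fact+
  show "card {X \<in> C. rank X = r \<and> T \<subseteq> supp X} = card {X \<in> C. rank X = r \<and> T' \<subseteq> supp X}"
    by (rule contain[OF assms dist[OF assms]])
qed

end

section \<open>Designs from invariance\<close>

text \<open>
  Invariance makes the number of codewords a constant multiple of the number of supports.
\<close>

lemma subspace_design_supports:
  fixes D :: "('a::{field,finite}^'m^'n) set"
  assumes inv: "invariant D u"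
    and cnt: "\<And>T T'. vec.subspace T \<Longrightarrow> vec.subspace T' \<Longrightarrow> vec.dim T = t \<Longrightarrow> vec.dim T' = t \<Longrightarrow>
      card {X \<in> D. rank X = u \<and> T \<subseteq> supp X} = card {X \<in> D. rank X = u \<and> T' \<subseteq> supp X}"
  shows "subspace_design t u (supports D u)"
proof -
  let ?B = "\<lambda>T. {U \<in> supports D u. T \<subseteq> U}"
  have const: "card (?B T) = card (?B T')"
    if T: "vec.subspace T" "vec.subspace T'" "vec.dim T = t" "vec.dim T' = t" for T T'
  proof (cases "supports D u = {}")
    case True
    then show ?thesis by simp
  next
    case False
    then obtain U0 where U0: "U0 \<in> supports D u" by blast
    let ?\<mu> = "card (with_supp D U0)"
    have pos: "?\<mu> > 0" using U0 by (auto simp: supports_def card_gt_0_iff)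
    have eq: "card {X \<in> D. rank X = u \<and> S \<subseteq> supp X} = card (?B S) * ?\<mu>" for S
    proof -
      let ?A = "{X \<in> D. rank X = u \<and> S \<subseteq> supp X}"
      have "supp ` ?A \<subseteq> ?B S"
        by (auto simp: supports_def with_supp_def rank_eq_dim_supp subspace_supp)
      then have "(\<Sum>X\<in>?A. 1) = (\<Sum>U\<in>?B S. of_nat (card {X\<in>?A. supp X = U}) * (1::nat))"
        by (intro sum_fun_comp) auto
      also have "\<dots> = (\<Sum>U\<in>?B S. ?\<mu>)"
      proof (intro sum.cong refl)
        fix U assume U: "U \<in> ?B S"
        then have "{X\<in>?A. supp X = U} = with_supp D U"
          by (auto simp: with_supp_def supports_def rank_eq_dim_supp)
        moreover have "card (with_supp D U) = ?\<mu>"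
          using inv U U0 unfolding invariant_def by blast
        ultimately show "of_nat (card {X\<in>?A. supp X = U}) * (1::nat) = ?\<mu>" by simp
      qed
      finally show ?thesis by simp
    qed
    show ?thesis using cnt[OF T] pos unfolding eq mult_cancel2 by linarith
  qed
  \<comment> \<open>If there is no subspace of dimension \<open>t\<close>, any number serves as the constant.\<close>
  let ?T0 = "SOME T :: ('a^'n) set. vec.subspace T \<and> vec.dim T = t"
  have "card (?B T) = card (?B ?T0)" if T: "vec.subspace T \<and> vec.dim T = t" for T
  proof -
    have "vec.subspace ?T0 \<and> vec.dim ?T0 = t" using T by (rule someI)
    with T show ?thesis by (intro const) blast+
  qed
  then show ?thesis
    unfolding subspace_design_def
    by (intro conjI exI[of _ "card (?B ?T0)"] allI impI) (auto simp: supports_def)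
qed

theorem theorem18:
  fixes C :: "('a::{field,finite}^'m^'n) set"
    and k d t w w' :: nat
  assumes "CARD('n) \<ge> 2" and "CARD('m) \<ge> 2"
    and "rank_code C k d"
    and "1 \<le> t" and "t < d"
    and "card {i \<in> {1..CARD('n) - t}. weight_count (dual_code C) i \<noteq> 0} \<le> d - t"
    and "d \<le> w" and "w \<le> CARD('n)"
    and "min_dist (dual_code C) \<le> w'" and "w' \<le> CARD('n)"
    and "\<And>u. d \<le> u \<Longrightarrow> u \<le> w \<Longrightarrow> invariant C u"
    and "\<And>u. min_dist (dual_code C) \<le> u \<Longrightarrow> u \<le> w' \<Longrightarrow> invariant (dual_code C) u"
  shows "(\<forall>u. d \<le> u \<and> u \<le> w \<longrightarrow> subspace_design t u (supports C u)) \<and>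
    (\<forall>u. min_dist (dual_code C) \<le> u \<and> u \<le> min w' (CARD('n) - t) \<longrightarrow>
      subspace_design t u (supports (dual_code C) u))"
proof -
  have "d \<le> rank X" if "X \<in> C" "X \<noteq> 0" for X
  proof -
    have "min_dist C \<le> rank X"
      unfolding min_dist_def using that by (intro Min_le) (auto simp: setcompr_eq_image)
    then show ?thesis using assms(3) by (simp add: rank_code_def)
  qed
  then interpret few_dual_weights C d t
    using assms(3) assms(5,6) by unfold_locales (simp_all only: rank_code_def)
  show ?thesis
  proof (intro conjI allI impI)
    fix u assume "d \<le> u \<and> u \<le> w"
    then have "invariant C u" using assms(11) by blast
    then show "subspace_design t u (supports C u)"
      by (rule subspace_design_supports) (rule code_incidence_counts(2), simp_all)
  next
    fix u assume "min_dist (dual_code C) \<le> u \<and> u \<le> min w' (CARD('n) - t)"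
    then have "invariant (dual_code C) u" using assms(12) by simp
    then show "subspace_design t u (supports (dual_code C) u)"
      by (rule subspace_design_supports) (rule dual_code_counts_containing[OF _ _ _ _ order_refl])
  qed
qed

end
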